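(* Let $s\ge 1$ and $1\le k\le s$ be integers and let $\alpha\in(0,1)$. For testing $H_i: P\in\omega_i$, $i=1,\ldots,s$, suppose that each p-value $\hat p_i$ satisfies $$P\{\hat p_i\le u\}\le u\quad\text{for any } u\in(0,1)\text{ and any } P\in\omega_i .$$ Then the stepdown procedure with constants $$\alpha_i=\begin{cases}\dfrac{k\alpha}{s}, & i\le k,\\[2mm] \dfrac{k\alpha}{s+k-i}, & i>k,\end{cases}\qquad i=1,\ldots,s,$$ controls the $k$-FWER at level $\alpha$, that is, $$P\{\text{reject at least } k \text{ hypotheses } H_i \text{ with } i\in I(P)\}\le\alpha\quad\text{for all } P\in\Omega .$$
   Context: Data $X$ is available from some model $P\in\Omega$, where $\Omega$ is a family of probability distributions. A hypothesis $H_i$ is identified with a subset $\omega_i\subset\Omega$ and asserts $P\in\omega_i$. $I(P)=\{i: P\in\omega_i\}$ is the set of indices of true null hypotheses when $P$ is the true distribution. The p-values $\hat p_1,\ldots,\hat p_s$ are $[0,1]$-valued statistics (functions of $X$); no assumption is made on their joint dependence structure. Let $\hat p_{(1)}\le\cdots\le\hat p_{(s)}$ be the ordered p-values and $H_{(1)},\ldots,H_{(s)}$ the associated hypotheses (ties ordered arbitrarily). Given constants $\alpha_1\le\alpha_2\le\cdots\le\alpha_s$, the stepdown procedure with these constants is: if $\hat p_{(1)}>\alpha_1$, reject no hypotheses; otherwise reject $H_{(1)},\ldots,H_{(r)}$, where $r$ is the largest index such that $\hat p_{(1)}\le\alpha_1,\ldots,\hat p_{(r)}\le\alpha_r$. 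*)

theory Defs
  imports "HOL-Probability.Probability"
begin

text \<open>
  The model is a set \<open>\<Omega>\<close> of probability measures, all on one sample space \<open>M\<close>; an outcome
  \<open>x\<close> is the data.  The hypotheses and p-values are indexed by \<open>{1..s}\<close>.
\<close>

definition model :: "'x measure \<Rightarrow> 'x measure set \<Rightarrow> bool" where
  "model M \<Omega> \<longleftrightarrow> (\<forall>P\<in>\<Omega>. prob_space P \<and> sets P = sets M)"

definition true_nulls :: "nat \<Rightarrow> (nat \<Rightarrow> 'x measure set) \<Rightarrow> 'x measure \<Rightarrow> nat set" where
  "true_nulls s \<omega> P = {i \<in> {1..s}. P \<in> \<omega> i}"

definition valid_pvalue :: "('x \<Rightarrow> real) \<Rightarrow> 'x measure set \<Rightarrow> bool" where
  "valid_pvalue p \<omega> \<longleftrightarrow>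
     (\<forall>u\<in>{0<..<1}. \<forall>P\<in>\<omega>. measure P {x \<in> space P. p x \<le> u} \<le> u)"

text \<open>
  \<open>\<sigma> j\<close> is the index of the hypothesis whose p-value is the \<open>j\<close>-th smallest of \<open>q 1, ..., q s\<close>.
  With ties several \<open>\<sigma>\<close> qualify.
\<close>

definition orders_pvalues :: "nat \<Rightarrow> (nat \<Rightarrow> real) \<Rightarrow> (nat \<Rightarrow> nat) \<Rightarrow> bool" where
  "orders_pvalues s q \<sigma> \<longleftrightarrow>
     bij_betw \<sigma> {1..s} {1..s} \<and> mono_on {1..s} (\<lambda>j. q (\<sigma> j))"

definition stepdown ::
    "nat \<Rightarrow> (nat \<Rightarrow> real) \<Rightarrow> (nat \<Rightarrow> real) \<Rightarrow> (nat \<Rightarrow> nat) \<Rightarrow> nat set" where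
  "stepdown s c q \<sigma> =
     (if q (\<sigma> 1) > c 1 then {}
      else \<sigma> ` {1..Max {r \<in> {1..s}. \<forall>j\<in>{1..r}. q (\<sigma> j) \<le> c j}})"

text \<open>
  Measurability of the error event is part of the definition because \<^term>\<open>measure P A\<close>
  is \<open>0\<close> for a non-measurable set \<open>A\<close>.
\<close>

definition controls_kFWER ::
    "'x measure set \<Rightarrow> nat \<Rightarrow> (nat \<Rightarrow> 'x measure set) \<Rightarrow> nat \<Rightarrow> real \<Rightarrow> ('x \<Rightarrow> nat set) \<Rightarrow> bool" where
  "controls_kFWER \<Omega> s \<omega> k \<alpha> R \<longleftrightarrow>
     (\<forall>P\<in>\<Omega>. {x \<in> space P. k \<le> card (R x \<inter> true_nulls s \<omega> P)} \<in> sets P \<and>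
             measure P {x \<in> space P. k \<le> card (R x \<inter> true_nulls s \<omega> P)} \<le> \<alpha>)"

definition kFWER_const :: "nat \<Rightarrow> nat \<Rightarrow> real \<Rightarrow> nat \<Rightarrow> real" where
  "kFWER_const s k \<alpha> i =
     (if i \<le> k then real k * \<alpha> / real s
      else real k * \<alpha> / (real s + real k - real i))"

end

theory Submission
  imports Defs
begin

text \<open>
  The bound rests on a deterministic fact about the procedure.  Let \<open>I\<close> be the set of true nulls, of
  size at least \<open>k\<close>, put \<open>u = k\<alpha> / |I|\<close>, and suppose that fewer than \<open>k\<close> true nulls have a p-value
  at most \<open>u\<close> although at least \<open>k\<close> true nulls are rejected.  Take the smallest p-value above \<open>u\<close> of a
  rejected true null.  Fewer than \<open>k\<close> true nulls and at most \<open>s - |I|\<close> false ones have a smaller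
  p-value, so it has rank at most \<open>s - |I| + k\<close>.  The constant at that rank is exactly \<open>u\<close>; since
  the constants increase, the p-value cannot have been above \<open>u\<close>.  Hence an error forces at least
  \<open>k\<close> true nulls to have p-values at most \<open>u\<close>.  The expected number of those is at most
  \<open>|I| u = k\<alpha>\<close>, and Markov's inequality gives \<open>\<alpha>\<close>, whatever the dependence.
  The deterministic part is \<open>many_small_pvalues_if_many_rejections\<close>, the probabilistic one
  \<open>prob_at_least_k_events_le\<close>.

  The error event also has to be measurable, although the ordering \<open>\<sigma>\<close> may break ties differently,
  and non-measurably, at each outcome.  Because the constants increase, tied hypotheses are rejected
  together, so the rejected set depends on the p-values alone: \<open>stepdown_eq_rejected\<close> describes it
  without an ordering, by finitely many comparisons between p-values and constants.
\<close>

section \<open>The stepdown procedure without an ordering\<close>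

text \<open>
  \<open>card {m. q m < q l} + 1\<close> is the lowest rank that the p-value \<open>q l\<close> can be given when ties are broken,
  so each p-value is compared with the strictest constant that it can meet.
\<close>

definition rejected :: "nat \<Rightarrow> (nat \<Rightarrow> real) \<Rightarrow> (nat \<Rightarrow> real) \<Rightarrow> nat set" where
  "rejected s c q = {i \<in> {1..s}. \<forall>l\<in>{1..s}. q l \<le> q i \<longrightarrow>
     q l \<le> c (card {m \<in> {1..s}. q m < q l} + 1)}"

text \<open>
  The ranks up to which all comparisons succeed form an initial segment, which is why it does not
  matter that the procedure is given through the maximum of that set.
\<close>

lemma stepdown_eq_image:
  assumes "1 \<le> s"
  shows "stepdown s c q \<sigma> = \<sigma> ` {r \<in> {1..s}. \<forall>j\<in>{1..r}. q (\<sigma> j) \<le> c j}"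
proof -
  define S where "S = {r \<in> {1..s}. \<forall>j\<in>{1..r}. q (\<sigma> j) \<le> c j}"
  have fin: "finite S" unfolding S_def by simp
  show ?thesis
  proof (cases "S = {}")
    case True
    then have "1 \<notin> S" by simp
    then have "q (\<sigma> 1) > c 1" using assms unfolding S_def by auto
    then have "stepdown s c q \<sigma> = {}" unfolding stepdown_def by simp
    then show ?thesis using True unfolding S_def by simp
  next
    case False
    have max: "Max S \<in> S" using Max_in[OF fin False] .
    have S_iff: "r \<in> S \<longleftrightarrow> r \<in> {1..s} \<and> (\<forall>j\<in>{1..r}. q (\<sigma> j) \<le> c j)" for r
      unfolding S_def by simp
    have "q (\<sigma> 1) \<le> c 1" using max S_iff[of "Max S"] by simp
    moreover have "{1..Max S} = S"
    proof
      show "S \<subseteq> {1..Max S}" using fin S_iff by (simp add: subset_iff)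
      show "{1..Max S} \<subseteq> S"
      proof
        fix r assume "r \<in> {1..Max S}"
        then show "r \<in> S" using max S_iff[of r] S_iff[of "Max S"] by simp
      qed
    qed
    ultimately show ?thesis unfolding stepdown_def S_def[symmetric] by simp
  qed
qed

lemma lowest_rank:
  fixes q :: "nat \<Rightarrow> real"
  assumes ord: "orders_pvalues s q \<sigma>" and j: "j \<in> {1..s}"
  defines "n \<equiv> card {m \<in> {1..s}. q m < q (\<sigma> j)} + 1"
  shows "n \<in> {1..j}" and "q (\<sigma> n) = q (\<sigma> j)"
proof -
  have bij: "bij_betw \<sigma> {1..s} {1..s}"
    and mono: "\<And>a b. 1 \<le> a \<Longrightarrow> a \<le> b \<Longrightarrow> b \<le> s \<Longrightarrow> q (\<sigma> a) \<le> q (\<sigma> b)"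
    using ord unfolding orders_pvalues_def mono_on_def by auto
  define A where "A = {m \<in> {1..s}. q m < q (\<sigma> j)}"
  have "A \<subseteq> \<sigma> ` {1..<j}"
  proof
    fix m assume m: "m \<in> A"
    then obtain a where a: "a \<in> {1..s}" "m = \<sigma> a"
      using bij unfolding A_def bij_betw_def by blast
    have "\<not> j \<le> a" using mono[of j a] a m j unfolding A_def by auto
    then show "m \<in> \<sigma> ` {1..<j}" using a by auto
  qed
  then have "card A \<le> card {1..<j}" by (meson surj_card_le finite_atLeastLessThan)
  then show n: "n \<in> {1..j}" using j unfolding n_def A_def by auto
  show "q (\<sigma> n) = q (\<sigma> j)"
  proof (rule antisym)
    show "q (\<sigma> n) \<le> q (\<sigma> j)" using mono n j by auto
    show "q (\<sigma> j) \<le> q (\<sigma> n)"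
    proof (rule ccontr)
      assume less: "\<not> q (\<sigma> j) \<le> q (\<sigma> n)"
      have "\<sigma> ` {1..n} \<subseteq> A"
      proof
        fix m assume "m \<in> \<sigma> ` {1..n}"
        then obtain a where a: "a \<in> {1..n}" "m = \<sigma> a" by blast
        have "\<sigma> a \<in> {1..s}" using bij a n j unfolding bij_betw_def by auto
        moreover have "q (\<sigma> a) \<le> q (\<sigma> n)" using mono a n j by auto
        ultimately show "m \<in> A" using less a unfolding A_def by auto
      qed
      then have "card (\<sigma> ` {1..n}) \<le> card A" by (intro card_mono) (auto simp: A_def)
      moreover have "inj_on \<sigma> {1..n}"
        using bij n j by (intro inj_on_subset[OF bij_betw_imp_inj_on[OF bij]]) auto
      ultimately show False unfolding n_def A_def by (simp add: card_image)
    qed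
  qed
qed

text \<open>
  Monotone constants make the choice of \<open>\<sigma>\<close> irrelevant: if a tied group passes at its lowest
  rank, it passes at all of its ranks.
\<close>

lemma stepdown_eq_rejected:
  assumes s: "1 \<le> s" and ord: "orders_pvalues s q \<sigma>"
    and mono_c: "mono_on {1..s} c"
  shows "stepdown s c q \<sigma> = rejected s c q"
proof -
  have bij: "\<sigma> ` {1..s} = {1..s}"
    and mono: "\<And>a b. 1 \<le> a \<Longrightarrow> a \<le> b \<Longrightarrow> b \<le> s \<Longrightarrow> q (\<sigma> a) \<le> q (\<sigma> b)"
    using ord unfolding orders_pvalues_def mono_on_def bij_betw_def by auto
  define N where "N l = card {m \<in> {1..s}. q m < q l} + 1" for l
  have rank: "N (\<sigma> j) \<in> {1..j}" "q (\<sigma> (N (\<sigma> j))) = q (\<sigma> j)" if "j \<in> {1..s}" for j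
    using lowest_rank[OF ord that] unfolding N_def by auto
  have passes_iff: "(\<forall>j\<in>{1..r}. q (\<sigma> j) \<le> c j) \<longleftrightarrow>
      (\<forall>l\<in>{1..s}. q l \<le> q (\<sigma> r) \<longrightarrow> q l \<le> c (N l))" if r: "r \<in> {1..s}" for r
  proof (intro iffI ballI impI)
    fix l assume all: "\<forall>j\<in>{1..r}. q (\<sigma> j) \<le> c j" and l: "l \<in> {1..s}" and le: "q l \<le> q (\<sigma> r)"
    obtain a where a: "a \<in> {1..s}" "l = \<sigma> a" using bij l by blast
    have "N l \<le> N (\<sigma> r)" using le unfolding N_def by (auto intro!: card_mono)
    then have "N l \<in> {1..r}" using rank(1)[OF r] rank(1)[OF a(1)] a by auto
    then have "q (\<sigma> (N l)) \<le> c (N l)" using all by blast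
    then show "q l \<le> c (N l)" using rank(2)[OF a(1)] a by simp
  next
    fix j assume all: "\<forall>l\<in>{1..s}. q l \<le> q (\<sigma> r) \<longrightarrow> q l \<le> c (N l)" and j: "j \<in> {1..r}"
    have js: "j \<in> {1..s}" and "\<sigma> j \<in> {1..s}" using j r bij by auto
    moreover have "q (\<sigma> j) \<le> q (\<sigma> r)" using mono j r by auto
    ultimately have "q (\<sigma> j) \<le> c (N (\<sigma> j))" using all by blast
    also have "\<dots> \<le> c j"
      using rank(1)[OF js] js by (intro mono_onD[OF mono_c]) auto
    finally show "q (\<sigma> j) \<le> c j" .
  qed
  have "stepdown s c q \<sigma> =
      \<sigma> ` {r \<in> {1..s}. \<forall>l\<in>{1..s}. q l \<le> q (\<sigma> r) \<longrightarrow> q l \<le> c (N l)}"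
    unfolding stepdown_eq_image[OF s] using passes_iff by (intro image_cong) auto
  also have "\<dots> = {i \<in> \<sigma> ` {1..s}. \<forall>l\<in>{1..s}. q l \<le> q i \<longrightarrow> q l \<le> c (N l)}"
    by blast
  finally show ?thesis unfolding bij rejected_def N_def .
qed

section \<open>Many rejected true nulls force many small p-values\<close>

lemma mono_on_kFWER_const:
  assumes "1 \<le> k" "k \<le> s" "0 < \<alpha>"
  shows "mono_on {1..s} (kFWER_const s k \<alpha>)"
proof (rule mono_onI)
  fix i j assume ij: "i \<in> {1..s}" "j \<in> {1..s}" "i \<le> j"
  have "real k * \<alpha> / real s \<le> real k * \<alpha> / (real s + real k - real j)" if "k < j"
    using assms ij that by (intro divide_left_mono mult_pos_pos) auto
  moreover have "real k * \<alpha> / (real s + real k - real i) \<le> real k * \<alpha> / (real s + real k - real j)"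
    using assms ij by (intro divide_left_mono mult_pos_pos) auto
  ultimately show "kFWER_const s k \<alpha> i \<le> kFWER_const s k \<alpha> j"
    using ij unfolding kFWER_const_def by auto
qed

text \<open>
  The worst case is that all false nulls have smaller p-values than the true ones; the rank
  \<open>s - card I + k\<close> allows for exactly that.
\<close>

lemma many_small_pvalues_if_many_rejections:
  fixes q :: "nat \<Rightarrow> real"
  assumes k: "1 \<le> k" and I: "I \<subseteq> {1..s}"
    and mono_c: "mono_on {1..s} c"
    and many: "k \<le> card (rejected s c q \<inter> I)"
  shows "k \<le> card {i \<in> I. q i \<le> c (s - card I + k)}"
proof (rule ccontr)
  define u where "u = c (s - card I + k)"
  define T where "T = rejected s c q \<inter> I"
  assume "\<not> k \<le> card {i \<in> I. q i \<le> c (s - card I + k)}"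
  then have few: "card {i \<in> I. q i \<le> u} < k" unfolding u_def by simp
  have finI: "finite I" using I finite_subset by blast
  then have finT: "finite T" unfolding T_def by simp
  define B where "B = {i \<in> T. u < q i}"
  have "B \<noteq> {}"
  proof
    assume "B = {}"
    then have "T \<subseteq> {i \<in> I. q i \<le> u}" unfolding B_def T_def by force
    then have "card T \<le> card {i \<in> I. q i \<le> u}" using finI by (intro card_mono) auto
    then show False using few many unfolding T_def by simp
  qed
  moreover have "finite B" using finT unfolding B_def by simp
  ultimately obtain i where i: "i \<in> B" and least: "\<And>j. j \<in> B \<Longrightarrow> q i \<le> q j"
    using arg_min_if_finite(1) arg_min_least by metis
  have iR: "i \<in> rejected s c q" and iu: "u < q i"
    using i unfolding B_def T_def by auto
  \<comment> \<open>Whatever lies below a rejected p-value is rejected too, so no true null lies between \<open>u\<close> and \<open>q i\<close>.\<close>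
  have "{m \<in> I. q m < q i} \<subseteq> {m \<in> I. q m \<le> u}"
  proof
    fix m assume m: "m \<in> {m \<in> I. q m < q i}"
    then have "m \<in> T" using iR I unfolding T_def rejected_def by fastforce
    then have "m \<notin> B \<Longrightarrow> q m \<le> u" unfolding B_def by auto
    moreover have "m \<notin> B" using least[of m] m by auto
    ultimately show "m \<in> {m \<in> I. q m \<le> u}" using m by simp
  qed
  then have "card {m \<in> I. q m < q i} \<le> card {m \<in> I. q m \<le> u}"
    using finI by (intro card_mono) auto
  then have below_I: "card {m \<in> I. q m < q i} < k" using few by simp
  have "card {m \<in> {1..s}. q m < q i} \<le> card ({m \<in> I. q m < q i} \<union> ({1..s} - I))"
    using finI by (intro card_mono) auto
  also have "\<dots> \<le> card {m \<in> I. q m < q i} + card ({1..s} - I)" by (rule card_Un_le)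
  also have "card ({1..s} - I) = s - card I" using I finI by (simp add: card_Diff_subset)
  finally have rank: "card {m \<in> {1..s}. q m < q i} + 1 \<le> s - card I + k"
    using below_I by simp
  have "card T \<le> card I" using finI unfolding T_def by (intro card_mono) auto
  moreover have "card I \<le> s" using card_mono[OF _ I] by simp
  ultimately have "s - card I + k \<le> s" using many unfolding T_def by simp
  then have "c (card {m \<in> {1..s}. q m < q i} + 1) \<le> u"
    unfolding u_def using rank k by (intro mono_onD[OF mono_c]) auto
  moreover have "q i \<le> c (card {m \<in> {1..s}. q m < q i} + 1)"
    using iR unfolding rejected_def by auto
  ultimately show False using iu by simp
qed

text \<open>
  Reading the formula for the constants backwards: they are chosen so that the rank which the
  \<open>k\<close>-th smallest of \<open>n\<close> true p-values cannot exceed gets the threshold that Markov's inequality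
  tolerates for \<open>n\<close> true nulls.
\<close>

lemma kFWER_const_at_critical_rank:
  assumes "n \<le> s"
  shows "kFWER_const s k \<alpha> (s - n + k) = real k * \<alpha> / real n"
  using assms unfolding kFWER_const_def by (auto simp: of_nat_diff)

section \<open>Probability of many events\<close>

lemma measurable_card_filter:
  fixes I :: "nat set"
  assumes "\<And>i. i \<in> I \<Longrightarrow> {x \<in> space M. Q i x} \<in> sets M"
  shows "(\<lambda>x. card {i \<in> I. Q i x}) \<in> measurable M (count_space UNIV)"
proof (rule measurable_card)
  show "{x \<in> space M. i \<in> {i \<in> I. Q i x}} \<in> sets M" for i
    using assms by (cases "i \<in> I") auto
qed

lemma sets_card_ge:
  fixes I :: "nat set"
  assumes "\<And>i. i \<in> I \<Longrightarrow> {x \<in> space M. Q i x} \<in> sets M"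
  shows "{x \<in> space M. k \<le> card {i \<in> I. Q i x}} \<in> sets M"
proof -
  have [measurable]: "(\<lambda>x. card {i \<in> I. Q i x}) \<in> measurable M (count_space UNIV)"
    using assms by (rule measurable_card_filter)
  show ?thesis by measurable
qed

text \<open>Markov's inequality for the number of events that occur.\<close>

lemma (in prob_space) prob_at_least_k_events_le:
  fixes I :: "nat set"
  assumes fin: "finite I" and ev: "\<And>i. i \<in> I \<Longrightarrow> {x \<in> space M. Q i x} \<in> events"
  shows "real k * prob {x \<in> space M. k \<le> card {i \<in> I. Q i x}} \<le>
    (\<Sum>i\<in>I. prob {x \<in> space M. Q i x})"
proof -
  define E where "E = {x \<in> space M. k \<le> card {i \<in> I. Q i x}}"
  define A where "A i = {x \<in> space M. Q i x}" for i
  have E: "E \<in> events" unfolding E_def using sets_card_ge[OF ev] .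
  have A: "\<And>i. i \<in> I \<Longrightarrow> A i \<in> events" using ev unfolding A_def .
  have "real k * prob E = expectation (\<lambda>x. real k * indicator E x)" using E by simp
  also have "\<dots> \<le> expectation (\<lambda>x. \<Sum>i\<in>I. indicator (A i) x)"
  proof (rule integral_mono)
    fix x assume x: "x \<in> space M"
    have "(\<Sum>i\<in>I. indicator (A i) x) = real (card {i \<in> I. Q i x})"
      using fin x by (simp add: A_def indicator_def sum.If_cases Int_def)
    then show "real k * indicator E x \<le> (\<Sum>i\<in>I. indicator (A i) x)"
      by (auto simp: E_def indicator_def)
  qed (use E A in \<open>auto intro!: integrable_sum integrable_mult_right simp: emeasure_eq_measure\<close>)
  also have "\<dots> = (\<Sum>i\<in>I. prob (A i))"
    using A by (subst Bochner_Integration.integral_sum) (auto simp: emeasure_eq_measure)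
  finally show ?thesis unfolding E_def A_def .
qed

section \<open>Control of the generalized familywise error rate\<close>

lemma sets_many_rejected:
  fixes p :: "nat \<Rightarrow> 'x \<Rightarrow> real"
  assumes meas: "\<And>i. i \<in> {1..s} \<Longrightarrow> p i \<in> borel_measurable M" and I: "I \<subseteq> {1..s}"
  shows "{x \<in> space M. k \<le> card (rejected s c (\<lambda>i. p i x) \<inter> I)} \<in> sets M"
proof -
  define Q where "Q i x \<longleftrightarrow> (\<forall>l\<in>{1..s}. p l x \<le> p i x \<longrightarrow>
      p l x \<le> c (card {m \<in> {1..s}. p m x < p l x} + 1))" for i x
  have "{x \<in> space M. Q i x} \<in> sets M" if "i \<in> I" for i
  proof -
    have [measurable]: "p i \<in> borel_measurable M" using that I meas by blast
    note meas[measurable]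
    have [measurable]:
      "(\<lambda>x. card {m \<in> {1..s}. p m x < p l x}) \<in> measurable M (count_space UNIV)"
      if "l \<in> {1..s}" for l
      using meas that by (intro measurable_card_filter) auto
    show ?thesis unfolding Q_def by measurable
  qed
  then have "{x \<in> space M. k \<le> card {i \<in> I. Q i x}} \<in> sets M"
    using I finite_subset by (intro sets_card_ge) blast+
  moreover have "rejected s c (\<lambda>i. p i x) \<inter> I = {i \<in> I. Q i x}" for x
    using I unfolding rejected_def Q_def by blast
  ultimately show ?thesis by simp
qed

theorem theorem2p2:
  fixes s k :: nat and \<alpha> :: real
    and M :: "'x measure" and \<Omega> :: "'x measure set"
    and \<omega> :: "nat \<Rightarrow> 'x measure set"
    and p :: "nat \<Rightarrow> 'x \<Rightarrow> real"
    and \<sigma> :: "'x \<Rightarrow> nat \<Rightarrow> nat"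
  assumes "1 \<le> s" and "1 \<le> k" and "k \<le> s"
    and "0 < \<alpha>" and "\<alpha> < 1"
    and "model M \<Omega>"
    and "\<And>i. i \<in> {1..s} \<Longrightarrow> \<omega> i \<subseteq> \<Omega>"
    and "\<And>i. i \<in> {1..s} \<Longrightarrow> p i \<in> borel_measurable M"
    and "\<And>i x. i \<in> {1..s} \<Longrightarrow> x \<in> space M \<Longrightarrow> p i x \<in> {0..1}"
    and "\<And>i. i \<in> {1..s} \<Longrightarrow> valid_pvalue (p i) (\<omega> i)"
    and "\<And>x. x \<in> space M \<Longrightarrow> orders_pvalues s (\<lambda>i. p i x) (\<sigma> x)"
  shows "controls_kFWER \<Omega> s \<omega> k \<alpha>
           (\<lambda>x. stepdown s (kFWER_const s k \<alpha>) (\<lambda>i. p i x) (\<sigma> x))"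
  unfolding controls_kFWER_def
proof
  fix P assume P: "P \<in> \<Omega>"
  define I where "I = true_nulls s \<omega> P"
  define c where "c = kFWER_const s k \<alpha>"
  define u where "u = real k * \<alpha> / real (card I)"
  define E where "E = {x \<in> space P. k \<le> card (rejected s c (\<lambda>i. p i x) \<inter> I)}"
  have sets_P: "sets P = sets M" and "prob_space P"
    using assms(6) P unfolding model_def by auto
  interpret prob_space P by fact
  have space_P: "space P = space M" using sets_P by (rule sets_eq_imp_space_eq)
  have meas: "\<And>i. i \<in> {1..s} \<Longrightarrow> p i \<in> borel_measurable P"
    using assms(8) measurable_cong_sets[OF sets_P refl] by blast
  have I: "I \<subseteq> {1..s}" unfolding I_def true_nulls_def by blast
  then have finI: "finite I" using finite_subset by blast
  have card_I: "card I \<le> s" using card_mono[OF _ I] by simp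
  have mono_c: "mono_on {1..s} c" unfolding c_def using mono_on_kFWER_const assms by blast
  have E_events: "E \<in> events" unfolding E_def by (rule sets_many_rejected[OF meas I])
  have "prob E \<le> \<alpha>"
  proof (cases "k \<le> card I")
    case False
    have "card (rejected s c (\<lambda>i. p i x) \<inter> I) \<le> card I" for x
      using finI by (intro card_mono) auto
    then have "E = {}" using False le_trans unfolding E_def by blast
    then show ?thesis using assms(4) by simp
  next
    case True
    then have pos: "0 < card I" using assms(2) by linarith
    have "real k * \<alpha> < real (card I) * 1"
      using True assms by (intro mult_le_less_imp_less) auto
    then have u: "u \<in> {0<..<1}" using pos assms unfolding u_def by (simp add: field_simps)
    have cu: "c (s - card I + k) = u"
      unfolding c_def u_def using card_I by (rule kFWER_const_at_critical_rank)
    have ev: "\<And>i. i \<in> I \<Longrightarrow> {x \<in> space P. p i x \<le> u} \<in> events"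
      using meas I by (auto intro!: borel_measurable_le)
    define F where "F = {x \<in> space P. k \<le> card {i \<in> I. p i x \<le> u}}"
    have "F \<in> events" unfolding F_def using sets_card_ge[OF ev] .
    moreover have "E \<subseteq> F"
      unfolding E_def F_def
      using many_small_pvalues_if_many_rejections[OF assms(2) I mono_c] cu by auto
    ultimately have "real k * prob E \<le> real k * prob F"
      by (intro mult_left_mono finite_measure_mono) auto
    also have "\<dots> \<le> (\<Sum>i\<in>I. prob {x \<in> space P. p i x \<le> u})"
      unfolding F_def by (rule prob_at_least_k_events_le[OF finI ev])
    also have "\<dots> \<le> (\<Sum>i\<in>I. u)"
      using assms(10) u unfolding valid_pvalue_def I_def true_nulls_def
      by (intro sum_mono) blast
    also have "\<dots> = real k * \<alpha>" using pos unfolding u_def by simp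
    finally show ?thesis using assms(2) by simp
  qed
  moreover have "{x \<in> space P. k \<le> card
      (stepdown s (kFWER_const s k \<alpha>) (\<lambda>i. p i x) (\<sigma> x) \<inter> true_nulls s \<omega> P)} = E"
    using stepdown_eq_rejected[OF assms(1,11) mono_c]
    unfolding E_def I_def space_P c_def by auto
  ultimately show "{x \<in> space P. k \<le> card
      (stepdown s (kFWER_const s k \<alpha>) (\<lambda>i. p i x) (\<sigma> x) \<inter> true_nulls s \<omega> P)} \<in> events \<and>
      prob {x \<in> space P. k \<le> card
      (stepdown s (kFWER_const s k \<alpha>) (\<lambda>i. p i x) (\<sigma> x) \<inter> true_nulls s \<omega> P)} \<le> \<alpha>"
    using E_events by simp
qed

end
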